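(* Let $(H,H')$ be a pair consisting of a right star $H$ and a right caterpillar $H'$, or a pair consisting of a left star $H$ and a left caterpillar $H'$, and let $d_1,\ldots,d_i$ be the defining sequence of the caterpillar $H'$. If either $i\le 2$ or $d_1\le d_2\le\cdots\le d_i$, then $(H,H')$ is Ramsey finite.
   Context: An ordered graph is a finite simple graph together with a linear order of its vertex set. A copy of an ordered graph $H$ in $F$ is a subgraph of $F$ (with inherited order) isomorphic to $H$ via an order-preserving bijection. $R_<(H,H')$ is the set of ordered graphs $F$ such that every red/blue coloring of the edges of $F$ contains a red copy of $H$ or a blue copy of $H'$; $F\in R_<(H,H')$ is minimal if no proper subgraph lies in $R_<(H,H')$; $(H,H')$ is Ramsey finite if $R_<(H,H')$ has finitely many minimal elements (up to order-preserving isomorphism). A right (left) star is an ordered star with all leaves to the right (left) of its center; $\vec S_p$ denotes the right star with $p$ edges. The concatenation $G\circ G'$ is obtained from the vertex-disjoint union with all vertices of $G$ before all vertices of $G'$ by identifying the rightmost vertex of $G$ with the leftmost vertex of $G'$. For $i\ge1$ and positive integers $d_1,\ldots,d_i$, the right caterpillar with defining sequence $d_1,\ldots,d_i$ is $\vec S_{d_i}\circ\cdots\circ\vec S_{d_1}$. A left caterpillar is the mirror image (order reversed) of a right caterpillar, with the defining sequence of that right caterpillar. *)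

theory Defs
  imports Main
begin

text \<open>
  The vertices of an ordered graph are natural numbers and carry the natural order. Every finite
  linear order is isomorphic to a finite set of natural numbers, and all notions below are
  invariant under order-preserving isomorphism, so this is no loss of generality.
  An edge is a two-element set of vertices.
\<close>

datatype ograph = OGraph (verts: "nat set") (edges: "nat set set")

definition ordered_graph :: "ograph \<Rightarrow> bool" where
  "ordered_graph G \<longleftrightarrow>
     finite (verts G) \<and> (\<forall>e \<in> edges G. e \<subseteq> verts G \<and> card e = 2)"

definition subgraph :: "ograph \<Rightarrow> ograph \<Rightarrow> bool" where
  "subgraph K F \<longleftrightarrow>
     ordered_graph K \<and> ordered_graph F \<and> verts K \<subseteq> verts F \<and> edges K \<subseteq> edges F"

definition order_iso :: "ograph \<Rightarrow> ograph \<Rightarrow> bool" where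
  "order_iso G G' \<longleftrightarrow>
     (\<exists>f. bij_betw f (verts G) (verts G') \<and> strict_mono_on (verts G) f \<and>
          edges G' = (\<lambda>e. f ` e) ` edges G)"

definition is_copy :: "ograph \<Rightarrow> ograph \<Rightarrow> ograph \<Rightarrow> bool" where
  "is_copy H F K \<longleftrightarrow> subgraph K F \<and> order_iso H K"

datatype colour = Red | Blue

text \<open>Colourings are total functions; only their values on the edges of \<open>F\<close> matter.\<close>

definition ramsey_graphs :: "ograph \<Rightarrow> ograph \<Rightarrow> ograph set" where
  "ramsey_graphs H H' =
     {F. ordered_graph F \<and>
         (\<forall>c :: nat set \<Rightarrow> colour.
            (\<exists>K. is_copy H F K \<and> (\<forall>e \<in> edges K. c e = Red)) \<or>
            (\<exists>K. is_copy H' F K \<and> (\<forall>e \<in> edges K. c e = Blue)))}"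

definition minimal_ramsey_graphs :: "ograph \<Rightarrow> ograph \<Rightarrow> ograph set" where
  "minimal_ramsey_graphs H H' =
     {F \<in> ramsey_graphs H H'. \<forall>K. subgraph K F \<and> K \<noteq> F \<longrightarrow> K \<notin> ramsey_graphs H H'}"

definition ramsey_finite :: "ograph \<Rightarrow> ograph \<Rightarrow> bool" where
  "ramsey_finite H H' \<longleftrightarrow>
     finite (minimal_ramsey_graphs H H' // {(F, F'). order_iso F F'})"

text \<open>A single vertex counts as a (right and left) star with no edges.\<close>

definition right_star :: "ograph \<Rightarrow> bool" where
  "right_star G \<longleftrightarrow> ordered_graph G \<and>
     (\<exists>c \<in> verts G. edges G = {{c, v} | v. v \<in> verts G - {c}} \<and> (\<forall>v \<in> verts G - {c}. c < v))"

definition left_star :: "ograph \<Rightarrow> bool" where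
  "left_star G \<longleftrightarrow> ordered_graph G \<and>
     (\<exists>c \<in> verts G. edges G = {{c, v} | v. v \<in> verts G - {c}} \<and> (\<forall>v \<in> verts G - {c}. v < c))"

definition rstar :: "nat \<Rightarrow> ograph" where
  "rstar p = OGraph {0..p} {{0, v} | v. v \<in> {1..p}}"

text \<open>
  The second graph is translated so that its leftmost vertex becomes the rightmost vertex of the
  first one; all its other vertices then lie to the right of the first graph. Both vertex sets
  are meant to be finite and nonempty.
\<close>

definition concatenation :: "ograph \<Rightarrow> ograph \<Rightarrow> ograph"  (infixl \<open>\<odot>\<close> 70) where
  "G \<odot> G' =
     (let t = (\<lambda>v. v - Min (verts G') + Max (verts G))
      in OGraph (verts G \<union> t ` verts G') (edges G \<union> (\<lambda>e. t ` e) ` edges G'))"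

definition mirror :: "ograph \<Rightarrow> ograph" where
  "mirror G =
     (let r = (\<lambda>v. Max (verts G) - v)
      in OGraph (r ` verts G) ((\<lambda>e. r ` e) ` edges G))"

text \<open>
  \<open>rcat [d\<^sub>1, \<dots>, d\<^sub>i]\<close> is \<open>rstar d\<^sub>i \<odot> \<dots> \<odot> rstar d\<^sub>1\<close>, so the head of the list is the rightmost
  star. The empty list gives a single vertex, which is neutral for concatenation
  on the graphs that occur here.
\<close>

primrec rcat :: "nat list \<Rightarrow> ograph" where
  "rcat [] = rstar 0"
| "rcat (d # ds) = rcat ds \<odot> rstar d"

definition right_caterpillar :: "nat list \<Rightarrow> ograph \<Rightarrow> bool" where
  "right_caterpillar ds G \<longleftrightarrow>
     ds \<noteq> [] \<and> (\<forall>d \<in> set ds. d \<ge> 1) \<and> order_iso (rcat ds) G"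

definition left_caterpillar :: "nat list \<Rightarrow> ograph \<Rightarrow> bool" where
  "left_caterpillar ds G \<longleftrightarrow>
     ds \<noteq> [] \<and> (\<forall>d \<in> set ds. d \<ge> 1) \<and> order_iso (mirror (rcat ds)) G"

lemma Min_Max_atMost: "Min {0..d::nat} = 0" "Max {0..d::nat} = d"
  by (rule Min_eqI Max_eqI; simp)+

lemma rcat_single: "rcat [d] = rstar d"
proof -
  have "rcat [d] = OGraph ({0} \<union> (\<lambda>v. v) ` {0..d}) ({} \<union> (\<lambda>e. (\<lambda>v. v) ` e) ` edges (rstar d))"
    by (simp add: concatenation_def rstar_def Let_def Min_Max_atMost)
  also have "\<dots> = rstar d"
    by (auto simp: rstar_def)
  finally show ?thesis .
qed

lemma ordered_graph_rstar: "ordered_graph (rstar p)"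
  by (auto simp: ordered_graph_def rstar_def)

lemma right_star_rstar: "right_star (rstar p)"
proof -
  have "{0..p} - {0} = {1..p}" by (rule set_eqI) (simp, arith)
  then have "edges (rstar p) = {{0, v} | v. v \<in> verts (rstar p) - {0}}"
    and "\<forall>v \<in> verts (rstar p) - {0}. 0 < v" and "0 \<in> verts (rstar p)"
    by (simp_all add: rstar_def)
  with ordered_graph_rstar show ?thesis
    unfolding right_star_def by blast
qed

lemma card_edges_rstar: "card (edges (rstar p)) = p"
proof -
  have "edges (rstar p) = (\<lambda>v. {0, v}) ` {1..p}"
    by (auto simp: rstar_def)
  moreover have "inj_on (\<lambda>v::nat. {0, v}) {1..p}"
    by (auto simp: inj_on_def doubleton_eq_iff)
  ultimately show ?thesis
    by (simp add: card_image)
qed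

lemma rcat_wf: "verts (rcat ds) = {0..sum_list ds} \<and> ordered_graph (rcat ds)"
proof (induction ds)
  case Nil
  show ?case using ordered_graph_rstar[of 0] by (simp add: rstar_def)
next
  case (Cons d ds)
  let ?s = "sum_list ds"
  let ?t = "\<lambda>v::nat. v + ?s"
  have vr: "verts (rstar d) = {0..d}" by (simp add: rstar_def)
  have e: "rcat (d # ds) = OGraph ({0..?s} \<union> ?t ` {0..d})
      (edges (rcat ds) \<union> (\<lambda>e. ?t ` e) ` edges (rstar d))"
    using Cons by (simp add: concatenation_def Let_def vr Min_Max_atMost)
  have "?t ` {0..d} = {?s..d + ?s}"
    by (simp only: image_add_atLeastAtMost' add_0)
  hence v: "verts (rcat (d # ds)) = {0..sum_list (d # ds)}" using e by auto
  have "x \<subseteq> verts (rcat (d # ds)) \<and> card x = 2" if "x \<in> edges (rcat (d # ds))" for x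
  proof -
    from that e consider "x \<in> edges (rcat ds)" | y where "y \<in> edges (rstar d)" "x = ?t ` y"
      by auto
    then show ?thesis
    proof cases
      case 1
      with Cons have "x \<subseteq> {0..?s}" "card x = 2" by (auto simp: ordered_graph_def)
      then show ?thesis unfolding v by auto
    next
      case 2
      with ordered_graph_rstar[of d] have "y \<subseteq> {0..d}" "card y = 2"
        by (auto simp: ordered_graph_def vr)
      moreover have "card x = card y" unfolding 2 by (rule card_image) simp
      ultimately show ?thesis unfolding v 2 by auto
    qed
  qed
  with v show ?case by (simp add: ordered_graph_def)
qed

end

theory Submission
  imports Defs "HOL-Library.Infinite_Set"
begin

text \<open>
  Every Ramsey graph contains one with a bounded number of vertices. A colouring without a red
  right star with \<open>r + 1\<close> edges deletes at most \<open>r\<close> right neighbours of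
  every vertex, and these deletions are independent of each other because every edge is charged to
  its left end. Working from the right end of the caterpillar, this gives a recursive set of
  vertices from which a blue copy cannot be prevented. Conversely a single colouring has to block
  all levels of the recursion at once: if \<open>d\<^sub>1 \<le> \<dots> \<le> d\<^sub>i\<close>
  the levels are nested and every vertex only has to block the lowest level that it can block, and
  for two stars it suffices to delete as many neighbours as possible. Finally, a family of sets of
  size \<open>d\<close> without a hitting set of size \<open>r\<close> contains a subfamily of
  bounded size with the same property, so membership in the recursive set is witnessed by
  boundedly many edges. Left stars and caterpillars are treated by reflection.
\<close>

section \<open>Forced vertices\<close>

definition rnbs :: "nat set set \<Rightarrow> nat \<Rightarrow> nat set" where
  "rnbs E x = {y. x < y \<and> {x, y} \<in> E}"

text \<open>There is no hitting set of size at most \<open>r\<close>. Finiteness of \<open>R\<close>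
  is demanded because \<open>card\<close> is 0 on infinite sets.\<close>

definition unhittable :: "nat \<Rightarrow> 'a set set \<Rightarrow> bool" where
  "unhittable r F \<longleftrightarrow> (\<forall>R. finite R \<and> card R \<le> r \<longrightarrow> (\<exists>T \<in> F. T \<inter> R = {}))"

lemma unhittableD:
  "unhittable r F \<Longrightarrow> finite R \<Longrightarrow> card R \<le> r \<Longrightarrow> \<exists>T \<in> F. T \<inter> R = {}"
  by (simp add: unhittable_def)

lemma unhittable_mono: "unhittable r F \<Longrightarrow> F \<subseteq> G \<Longrightarrow> unhittable r G"
  unfolding unhittable_def by blast

text \<open>
  The list is the defining sequence reversed, so its head is the leftmost star of the caterpillar.
  \<open>x \<in> forced r E es\<close> says that a monochromatic caterpillar from \<open>x\<close> survives however
  an opponent deletes at most \<open>r\<close> right neighbours of every vertex.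
\<close>

primrec forced :: "nat \<Rightarrow> nat set set \<Rightarrow> nat list \<Rightarrow> nat set" where
  "forced r E [] = UNIV"
| "forced r E (d # es) =
     {x. unhittable r {T. T \<subseteq> rnbs E x \<and> card T = d \<and> Max T \<in> forced r E es}}"

declare forced.simps(2) [simp del]

text \<open>Read as a game, \<open>R\<close> is what the opponent deletes at \<open>x\<close>, and
  \<open>T\<close> holds the leaves of a surviving star. Its rightmost leaf \<open>Max T\<close> is
  the centre of the next star.\<close>

lemma forced_Cons:
  "forced r E (d # es) =
     {x. \<forall>R. finite R \<and> card R \<le> r \<longrightarrow>
           (\<exists>T \<subseteq> rnbs E x. card T = d \<and> T \<inter> R = {} \<and> Max T \<in> forced r E es)}"
proof -
  have "(\<exists>T \<in> {T. T \<subseteq> rnbs E x \<and> card T = d \<and> Max T \<in> forced r E es}. T \<inter> R = {}) \<longleftrightarrow>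
      (\<exists>T \<subseteq> rnbs E x. card T = d \<and> T \<inter> R = {} \<and> Max T \<in> forced r E es)" for x R
    by blast
  then show ?thesis
    by (simp add: forced.simps(2) unhittable_def)
qed

text \<open>Nothing is deleted for \<open>r = 0\<close>, so for positive entries these are the left
  ends of actual caterpillars in \<open>E\<close>. The same recursion thus describes monochromatic
  copies.\<close>

lemma forced_0_Cons:
  "forced 0 E (d # es) = {x. \<exists>T \<subseteq> rnbs E x. card T = d \<and> Max T \<in> forced 0 E es}"
proof -
  have "finite R \<and> card R \<le> 0 \<longleftrightarrow> R = {}" for R :: "nat set"
    by auto
  then show ?thesis
    by (simp add: forced_Cons)
qed

lemma finite_rnbs: "finite E \<Longrightarrow> finite (rnbs E x)"
proof -
  assume "finite E"
  then have "finite ((\<lambda>y. {x, y}) ` rnbs E x)"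
    by (rule finite_subset[rotated]) (auto simp: rnbs_def)
  moreover have "inj_on (\<lambda>y. {x, y}) (rnbs E x)"
    by (auto simp: inj_on_def doubleton_eq_iff)
  ultimately show ?thesis
    by (rule finite_imageD)
qed

lemma rnbs_mono: "E \<subseteq> E' \<Longrightarrow> rnbs E x \<subseteq> rnbs E' x"
  by (auto simp: rnbs_def)

lemma forced_mono: "E \<subseteq> E' \<Longrightarrow> forced r E es \<subseteq> forced r E' es"
proof (induction es)
  case (Cons d es)
  then have "forced r E es \<subseteq> forced r E' es" by simp
  with rnbs_mono[OF Cons.prems] show ?case
    unfolding forced.simps(2) by (intro Collect_mono impI) (erule unhittable_mono, blast)
qed simp

text \<open>The star chosen against \<open>R x\<close> survives in \<open>E'\<close>, and induction
  continues from its last leaf. In the application \<open>E'\<close> is the blue graph and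
  \<open>R x\<close> holds the red right neighbours.\<close>

lemma forced_remove:
  assumes "\<And>x. rnbs E x - rnbs E' x \<subseteq> R x" "\<And>x. finite (R x) \<and> card (R x) \<le> r"
  shows "forced r E es \<subseteq> forced 0 E' es"
proof (induction es)
  case (Cons d es)
  show ?case
  proof
    fix x assume "x \<in> forced r E (d # es)"
    then obtain T where T: "T \<subseteq> rnbs E x" "card T = d" "T \<inter> R x = {}" "Max T \<in> forced r E es"
      using assms(2) unfolding forced_Cons by blast
    have "T \<subseteq> rnbs E' x"
      using T(1,3) assms(1)[of x] by blast
    moreover have "Max T \<in> forced 0 E' es"
      using T(4) Cons by (rule rev_subsetD)
    ultimately show "x \<in> forced 0 E' (d # es)"
      unfolding forced_0_Cons using T(2) by blast
  qed
qed simp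

text \<open>A star can lose leaves without moving the centre of the next star.\<close>

lemma subset_with_Max:
  fixes T :: "nat set"
  assumes "1 \<le> d" "d \<le> card T"
  obtains T' where "T' \<subseteq> T" "card T' = d" "Max T' = Max T"
proof -
  have T: "finite T" "T \<noteq> {}"
    using assms by (auto intro: card_ge_0_finite)
  then have "{Max T} \<subseteq> T"
    by simp
  with assms T obtain T' where T': "{Max T} \<subseteq> T'" "T' \<subseteq> T" "card T' = d"
    using exists_subset_between[of "{Max T}" d T] by auto
  with T have "Max T' = Max T"
    by (intro Max_eqI) (auto intro: finite_subset)
  with T' that show thesis by blast
qed

text \<open>Cut the first star down to \<open>d'\<close> leaves but keep its last leaf, which lies
  in the shorter level by induction. Hence the levels are nested.\<close>

lemma forced_tl:
  assumes "sorted_wrt (\<ge>) (d # es)" "\<forall>d \<in> set (d # es). 1 \<le> d"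
  shows "forced r E (d # es) \<subseteq> forced r E es"
  using assms
proof (induction es arbitrary: d)
  case (Cons d' es)
  show ?case
  proof
    fix x assume x: "x \<in> forced r E (d # d' # es)"
    have "\<exists>T \<subseteq> rnbs E x. card T = d' \<and> T \<inter> R = {} \<and> Max T \<in> forced r E es"
      if R: "finite R \<and> card R \<le> r" for R
    proof -
      from x R obtain T where T: "T \<subseteq> rnbs E x" "card T = d" "T \<inter> R = {}"
        "Max T \<in> forced r E (d' # es)"
        by (simp only: forced_Cons) blast
      obtain T' where "T' \<subseteq> T" "card T' = d'" "Max T' = Max T"
        using subset_with_Max[of d' T] T(2) Cons.prems by auto
      moreover have "Max T \<in> forced r E es"
        using T(4) Cons.IH[of d'] Cons.prems by auto
      ultimately show ?thesis
        using T by (intro exI[of _ T']) auto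
    qed
    then show "x \<in> forced r E (d' # es)" by (simp add: forced_Cons)
  qed
qed simp

section \<open>The colouring strategy\<close>

text \<open>A colouring fixes one deletion set per vertex, so the same \<open>R\<close> must block
  \<open>x\<close> at every level where \<open>x\<close> is not forced. The levels are the nonempty
  suffixes of \<open>es\<close>.\<close>

definition avoids :: "nat \<Rightarrow> nat set set \<Rightarrow> nat \<Rightarrow> nat set \<Rightarrow> nat list \<Rightarrow> bool" where
  "avoids r E x R es \<longleftrightarrow> finite R \<and> card R \<le> r \<and>
     (\<forall>us d vs. es = us @ d # vs \<and> x \<notin> forced r E (d # vs) \<longrightarrow>
        \<not> (\<exists>T \<subseteq> rnbs E x. card T = d \<and> T \<inter> R = {} \<and> Max T \<in> forced r E vs))"

lemma forced_drop:
  assumes "sorted_wrt (\<ge>) (us @ vs)" "\<forall>d \<in> set (us @ vs). 1 \<le> d"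
  shows "forced r E (us @ vs) \<subseteq> forced r E vs"
  using assms
proof (induction us)
  case (Cons u us)
  then show ?case
    using forced_tl[of u "us @ vs" r E] by auto
qed simp

text \<open>If \<open>x\<close> is forced for the tail \<open>es\<close>, then by nestedness also
  for all shorter suffixes, and only the full list can need blocking. Otherwise the set that works
  for \<open>es\<close> also works for the full list.\<close>

lemma avoids_sorted:
  assumes "sorted_wrt (\<ge>) es" "\<forall>d \<in> set es. 1 \<le> d"
  shows "\<exists>R. avoids r E x R es"
  using assms
proof (induction es)
  case Nil
  show ?case by (intro exI[of _ "{}"]) (simp add: avoids_def)
next
  case (Cons d es)
  show ?case
  proof (cases "x \<in> forced r E es")
    case True
    have drop: "x \<in> forced r E vs" if "es = us @ vs" for us vs
      using forced_drop[of us vs r E] True that Cons.prems by auto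
    obtain R where R: "finite R \<and> card R \<le> r" and "x \<notin> forced r E (d # es) \<longrightarrow>
        \<not> (\<exists>T \<subseteq> rnbs E x. card T = d \<and> T \<inter> R = {} \<and> Max T \<in> forced r E es)"
    proof (cases "x \<in> forced r E (d # es)")
      case True
      show ?thesis by (rule that[of "{}"]) (simp_all add: True)
    next
      case False
      then obtain R where "finite R \<and> card R \<le> r"
        "\<not> (\<exists>T \<subseteq> rnbs E x. card T = d \<and> T \<inter> R = {} \<and> Max T \<in> forced r E es)"
        by (simp only: forced_Cons) blast
      then show ?thesis by (intro that[of R]) auto
    qed
    then have "avoids r E x R (d # es)"
      unfolding avoids_def using drop by (auto simp: Cons_eq_append_conv)
    then show ?thesis ..
  next
    case False
    \<comment> \<open>\<open>es\<close> is nonempty because every vertex lies in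
      \<open>forced r E []\<close>.\<close>
    then obtain d' es' where es: "es = d' # es'"
      by (cases es) auto
    from Cons obtain R where R: "avoids r E x R es"
      by auto
    \<comment> \<open>Such a star would shrink to one with \<open>d'\<close> leaves and the same
      last leaf, which \<open>R\<close> already excludes at level \<open>es\<close>.\<close>
    have "\<not> (\<exists>T \<subseteq> rnbs E x. card T = d \<and> T \<inter> R = {} \<and> Max T \<in> forced r E es)"
    proof
      assume "\<exists>T \<subseteq> rnbs E x. card T = d \<and> T \<inter> R = {} \<and> Max T \<in> forced r E es"
      then obtain T where T: "T \<subseteq> rnbs E x" "card T = d" "T \<inter> R = {}" "Max T \<in> forced r E es"
        by blast
      obtain T' where "T' \<subseteq> T" "card T' = d'" "Max T' = Max T"
        using subset_with_Max[of d' T] T(2) Cons.prems es by auto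
      moreover have "Max T \<in> forced r E es'"
        using T(4) forced_tl[of d' es' r E] Cons.prems es by auto
      ultimately have "\<exists>T \<subseteq> rnbs E x. card T = d' \<and> T \<inter> R = {} \<and> Max T \<in> forced r E es'"
        using T by (intro exI[of _ T']) auto
      with R False show False
        unfolding avoids_def es by blast
    qed
    with R have "avoids r E x R (d # es)"
      unfolding avoids_def by (auto simp: Cons_eq_append_conv)
    then show ?thesis ..
  qed
qed

text \<open>
  Removing as many right neighbours as possible from a vertex which is not forced to be the centre
  of the rightmost star leaves fewer than \<open>d\<^sub>1\<close> of them, so a removal set that is good for
  the longer caterpillar can be enlarged to one that is good for both.
\<close>

lemma avoids_two:
  assumes "finite E" "x \<notin> forced r E [b, a]"
  shows "\<exists>R. avoids r E x R [b, a]"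
proof -
  from assms(2) obtain R where R: "finite R \<and> card R \<le> r" and
    nR: "\<not> (\<exists>T \<subseteq> rnbs E x. card T = b \<and> T \<inter> R = {} \<and> Max T \<in> forced r E [a])"
    by (simp only: forced_Cons) blast
  let ?N = "rnbs E x"
  have N: "finite ?N"
    using assms(1) by (rule finite_rnbs)
  \<comment> \<open>Only deletions inside \<open>?N\<close> matter, so \<open>R\<close> is cut down
    to \<open>?N\<close> and then filled up until the budget \<open>r\<close> or \<open>?N\<close>
    is exhausted.\<close>
  have "\<exists>R'. R \<inter> ?N \<subseteq> R' \<and> R' \<subseteq> ?N \<and> card R' = min r (card ?N)"
  proof (rule exists_subset_between)
    show "card (R \<inter> ?N) \<le> min r (card ?N)"
      using card_mono[of R "R \<inter> ?N"] card_mono[OF N, of "R \<inter> ?N"] R by auto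
  qed (use N in auto)
  then obtain R' where R': "R \<inter> ?N \<subseteq> R'" "R' \<subseteq> ?N" "card R' = min r (card ?N)"
    by blast
  have fin: "finite R'"
    using R'(2) N by (rule finite_subset)
  have "\<not> (\<exists>T \<subseteq> ?N. card T = a \<and> T \<inter> R' = {})" if x: "x \<notin> forced r E [a]"
  proof
    assume "\<exists>T \<subseteq> ?N. card T = a \<and> T \<inter> R' = {}"
    then obtain T where T: "T \<subseteq> ?N" "card T = a" "T \<inter> R' = {}"
      by blast
    from x obtain R0 where R0: "finite R0 \<and> card R0 \<le> r"
      and n: "\<not> (\<exists>T \<subseteq> ?N. card T = a \<and> T \<inter> R0 = {})"
      by (auto simp: forced_Cons)
    \<comment> \<open>The last star puts no condition on its last leaf, so only the number of
      remaining neighbours counts. \<open>R0\<close> leaves fewer than \<open>a\<close>, and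
      \<open>R'\<close> leaves no more than \<open>R0\<close> does.\<close>
    have "card (?N - R0) < a"
    proof (rule ccontr)
      assume "\<not> card (?N - R0) < a"
      then obtain T where "T \<subseteq> ?N - R0" "card T = a"
        by (metis not_less obtain_subset_with_card_n)
      with n show False by blast
    qed
    moreover have "card ?N - card R0 \<le> card (?N - R0)"
      using R0 by (intro diff_card_le_card_Diff) auto
    moreover have "card T \<le> card (?N - R')"
      using T N by (intro card_mono) auto
    moreover have "card (?N - R') = card ?N - card R'"
      using R' fin by (simp add: card_Diff_subset)
    ultimately show False
      using T(2) R0 R'(3) by auto
  qed
  moreover have "\<not> (\<exists>T \<subseteq> ?N. card T = b \<and> T \<inter> R' = {} \<and> Max T \<in> forced r E [a])"
    using nR R'(1) by blast
  ultimately have "avoids r E x R' [b, a]"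
    unfolding avoids_def using fin R'(3) by (auto simp: Cons_eq_append_conv)
  then show ?thesis ..
qed

text \<open>Here \<open>E'\<close> is the blue graph. A blue star at \<open>x\<close> avoids
  \<open>R x\<close> and inductively ends in a forced vertex; if \<open>x\<close> were not forced,
  \<open>R x\<close> would have blocked it.\<close>

lemma forced_0_subset:
  assumes av: "\<And>x. avoids r E x (R x) es" and sub: "\<And>x. rnbs E' x \<subseteq> rnbs E x - R x"
  shows "forced 0 E' es \<subseteq> forced r E es"
proof -
  have "forced 0 E' vs \<subseteq> forced r E vs" if "es = us @ vs" for us vs
    using that
  proof (induction vs arbitrary: us)
    case (Cons d vs)
    show ?case
    proof
      fix x assume "x \<in> forced 0 E' (d # vs)"
      then obtain T where T: "T \<subseteq> rnbs E' x" "card T = d" "Max T \<in> forced 0 E' vs"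
        unfolding forced_0_Cons by blast
      moreover have "forced 0 E' vs \<subseteq> forced r E vs"
        using Cons.IH[of "us @ [d]"] Cons.prems by simp
      ultimately have "\<exists>T \<subseteq> rnbs E x. card T = d \<and> T \<inter> R x = {} \<and> Max T \<in> forced r E vs"
        using sub[of x] by blast
      with av[of x] Cons.prems show "x \<in> forced r E (d # vs)"
        unfolding avoids_def by blast
    qed
  qed simp
  then show ?thesis by simp
qed

section \<open>Small witnesses\<close>

text \<open>
  Branch on the at most \<open>d\<close> elements that a hitting set can have in common with a fixed member.
\<close>

lemma unhittable_subfamily:
  "\<exists>n. \<forall>F :: 'a set set. (\<forall>T \<in> F. finite T \<and> card T \<le> d) \<longrightarrow> unhittable r F \<longrightarrow>
     (\<exists>G \<subseteq> F. finite G \<and> card G \<le> n \<and> unhittable r G)"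
proof (induction r)
  case 0
  have "\<exists>G \<subseteq> F. finite G \<and> card G \<le> 1 \<and> unhittable 0 G"
    if F: "unhittable 0 F" for F :: "'a set set"
  proof -
    from unhittableD[OF F, of "{}"] obtain T where "T \<in> F" by auto
    then show ?thesis by (intro exI[of _ "{T}"]) (auto simp: unhittable_def)
  qed
  then show ?case by (intro exI[of _ 1]) simp
next
  case (Suc r)
  then obtain n where n: "\<forall>F :: 'a set set. (\<forall>T \<in> F. finite T \<and> card T \<le> d) \<longrightarrow>
     unhittable r F \<longrightarrow> (\<exists>G \<subseteq> F. finite G \<and> card G \<le> n \<and> unhittable r G)" ..
  have "\<exists>G \<subseteq> F. finite G \<and> card G \<le> Suc (d * n) \<and> unhittable (Suc r) G"
    if fin: "\<forall>T \<in> F. finite T \<and> card T \<le> d" and F: "unhittable (Suc r) F" for F :: "'a set set"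
  proof -
    from unhittableD[OF F, of "{}"] obtain T where T: "T \<in> F" by auto
    have "\<exists>G \<subseteq> {S \<in> F. t \<notin> S}. finite G \<and> card G \<le> n \<and> unhittable r G" for t
    proof (rule n[rule_format])
      show "unhittable r {S \<in> F. t \<notin> S}"
        unfolding unhittable_def
      proof (intro allI impI)
        fix R :: "'a set" assume "finite R \<and> card R \<le> r"
        then have "finite (insert t R)" "card (insert t R) \<le> Suc r"
          by (auto simp: card_insert_if)
        from unhittableD[OF F this] obtain S where "S \<in> F" "S \<inter> insert t R = {}" ..
        then show "\<exists>T \<in> {S \<in> F. t \<notin> S}. T \<inter> R = {}" by auto
      qed
    qed (use fin in auto)
    then obtain G where G: "\<And>t. G t \<subseteq> {S \<in> F. t \<notin> S}" "\<And>t. finite (G t)"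
        "\<And>t. card (G t) \<le> n" "\<And>t. unhittable r (G t)"
      by metis
    \<comment> \<open>If \<open>R\<close> misses \<open>T\<close>, then \<open>T\<close> itself is
      the unhit member. Otherwise \<open>R\<close> spends one element on some \<open>t\<close> in
      \<open>T\<close>, and the rest fails against \<open>G t\<close>, whose members do not contain
      \<open>t\<close>.\<close>
    let ?G = "insert T (\<Union>t \<in> T. G t)"
    have "card (\<Union>t \<in> T. G t) \<le> (\<Sum>t \<in> T. card (G t))"
      using fin T by (intro card_UN_le) auto
    also have "\<dots> \<le> card T * n"
      using G(3) sum_bounded_above[of T "\<lambda>t. card (G t)" n] by auto
    also have "\<dots> \<le> d * n"
      using fin T by auto
    finally have "card ?G \<le> Suc (d * n)"
      using card_insert_le_m1[of "Suc (d * n)" "\<Union>t \<in> T. G t" T] by simp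
    moreover have "finite ?G"
      using fin T G(2) by auto
    moreover have "unhittable (Suc r) ?G"
      unfolding unhittable_def
    proof (intro allI impI)
      fix R :: "'a set" assume R: "finite R \<and> card R \<le> Suc r"
      show "\<exists>S \<in> ?G. S \<inter> R = {}"
      proof (cases "T \<inter> R = {}")
        case False
        then obtain t where t: "t \<in> T" "t \<in> R" by blast
        with R have "finite (R - {t})" "card (R - {t}) \<le> r" by auto
        from unhittableD[OF G(4)[of t] this] obtain S where S: "S \<in> G t" "S \<inter> (R - {t}) = {}" ..
        with G(1)[of t] have "t \<notin> S" by auto
        with S t show ?thesis by blast
      qed simp
    qed
    moreover have "?G \<subseteq> F"
      using T G(1) by auto
    ultimately show ?thesis by (intro exI[of _ ?G]) simp
  qed
  then show ?case by (intro exI[of _ "Suc (d * n)"]) simp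
qed

text \<open>The bound depends on \<open>r\<close> and \<open>es\<close> only, not on
  \<open>E\<close> or \<open>x\<close>. A bounded unhittable family of stars suffices at
  \<open>x\<close>, and induction supplies witnesses for their last leaves.\<close>

lemma forced_witness:
  assumes "\<forall>d \<in> set es. 1 \<le> d"
  shows "\<exists>n. \<forall>E x. x \<in> forced r E es \<longrightarrow>
    (\<exists>W \<subseteq> E. finite W \<and> card W \<le> n \<and> x \<in> forced r W es)"
  using assms
proof (induction es)
  case Nil
  show ?case by (intro exI[of _ 0] allI impI exI[of _ "{}"]) simp
next
  case (Cons d es)
  then obtain n where n: "\<forall>E x. x \<in> forced r E es \<longrightarrow>
      (\<exists>W \<subseteq> E. finite W \<and> card W \<le> n \<and> x \<in> forced r W es)"
    by auto
  from unhittable_subfamily[where d = d and r = r]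
  obtain m where m: "\<forall>F :: nat set set. (\<forall>T \<in> F. finite T \<and> card T \<le> d) \<longrightarrow>
     unhittable r F \<longrightarrow> (\<exists>G \<subseteq> F. finite G \<and> card G \<le> m \<and> unhittable r G)" ..
  show ?case
  \<comment> \<open>At most \<open>m\<close> stars, each with \<open>d\<close> edges of its own and
    \<open>n\<close> edges witnessing that its last leaf is forced.\<close>
  proof (intro exI[of _ "m * (d + n)"] allI impI)
    fix E x assume x: "x \<in> forced r E (d # es)"
    let ?F = "{T. T \<subseteq> rnbs E x \<and> card T = d \<and> Max T \<in> forced r E es}"
    have fin: "\<forall>T \<in> ?F. finite T \<and> card T \<le> d"
      using Cons.prems by (auto intro: card_ge_0_finite)
    moreover have "unhittable r ?F"
      using x by (simp add: forced.simps(2))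
    ultimately have "\<exists>G \<subseteq> ?F. finite G \<and> card G \<le> m \<and> unhittable r G"
      by (rule m[THEN spec, THEN mp, THEN mp])
    then obtain G where G: "G \<subseteq> ?F" "finite G" "card G \<le> m" "unhittable r G"
      by (elim exE conjE)
    have "\<exists>W \<subseteq> E. finite W \<and> card W \<le> n \<and> Max T \<in> forced r W es" if "T \<in> G" for T
    proof (rule n[rule_format])
      show "Max T \<in> forced r E es" using that G(1) by auto
    qed
    then obtain W where W: "\<And>T. T \<in> G \<Longrightarrow> W T \<subseteq> E" "\<And>T. T \<in> G \<Longrightarrow> finite (W T)"
        "\<And>T. T \<in> G \<Longrightarrow> card (W T) \<le> n" "\<And>T. T \<in> G \<Longrightarrow> Max T \<in> forced r (W T) es"
      by metis
    let ?S = "\<lambda>T. (\<lambda>y. {x, y}) ` T"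
    let ?W = "\<Union>T \<in> G. ?S T \<union> W T"
    have GT: "T \<subseteq> rnbs E x" "card T = d" "finite T" if "T \<in> G" for T
      using subsetD[OF G(1) that] Cons.prems by (auto intro: card_ge_0_finite)
    have sub: "?W \<subseteq> E"
    proof (intro UN_least Un_least)
      fix T assume "T \<in> G"
      then have "T \<subseteq> rnbs E x" by (rule GT(1))
      then show "?S T \<subseteq> E" by (auto simp: rnbs_def)
    qed (rule W(1))
    have "card (?S T \<union> W T) \<le> d + n" if T: "T \<in> G" for T
    proof -
      have "card (?S T) \<le> d"
        using card_image_le[OF GT(3)[OF T], of "\<lambda>y. {x, y}"] GT(2)[OF T] by simp
      moreover have "card (?S T \<union> W T) \<le> card (?S T) + card (W T)"
        by (rule card_Un_le)
      ultimately show ?thesis using W(3)[OF T] by linarith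
    qed
    then have "(\<Sum>T \<in> G. card (?S T \<union> W T)) \<le> card G * (d + n)"
      using sum_bounded_above[of G "\<lambda>T. card (?S T \<union> W T)" "d + n"] by auto
    moreover have "card ?W \<le> (\<Sum>T \<in> G. card (?S T \<union> W T))"
      using G(2) by (rule card_UN_le)
    moreover have "card G * (d + n) \<le> m * (d + n)"
      using G(3) by (rule mult_right_mono) simp
    ultimately have "card ?W \<le> m * (d + n)" by linarith
    moreover have "finite ?W"
      using G(2) GT(3) W(2) by simp
    moreover have "x \<in> forced r ?W (d # es)"
    proof -
      have "T \<subseteq> rnbs ?W x \<and> card T = d \<and> Max T \<in> forced r ?W es" if T: "T \<in> G" for T
      proof (intro conjI)
        show "T \<subseteq> rnbs ?W x"
          using GT(1)[OF T] T by (auto simp: rnbs_def)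
        show "card T = d"
          using T by (rule GT(2))
        have "W T \<subseteq> ?W" using T by auto
        then show "Max T \<in> forced r ?W es"
          using W(4)[OF T] forced_mono[of "W T" ?W r es] by blast
      qed
      then have "G \<subseteq> {T. T \<subseteq> rnbs ?W x \<and> card T = d \<and> Max T \<in> forced r ?W es}"
        by blast
      with G(4) show ?thesis
        unfolding forced.simps(2) mem_Collect_eq by (rule unhittable_mono)
    qed
    ultimately show "\<exists>W \<subseteq> E. finite W \<and> card W \<le> m * (d + n) \<and> x \<in> forced r W (d # es)"
      using sub by (intro exI[of _ ?W] conjI)
  qed
qed

section \<open>Copies of caterpillars\<close>

text \<open>\<open>x\<close> and \<open>z\<close> are the left and right ends. The list has the
  order of \<open>rcat\<close>, rightmost star first, which is the reverse of the order in
  \<open>forced\<close>.\<close>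

primrec cat_path :: "nat set set \<Rightarrow> nat list \<Rightarrow> nat \<Rightarrow> nat \<Rightarrow> bool" where
  "cat_path E [] x z \<longleftrightarrow> x = z"
| "cat_path E (d # ds) x z \<longleftrightarrow>
     (\<exists>y. cat_path E ds x y \<and> (\<exists>T \<subseteq> rnbs E y. card T = d \<and> Max T = z))"

text \<open>Peeling off the leftmost star instead of the rightmost one gives the recursion of
  \<open>forced\<close>.\<close>

lemma cat_path_snoc:
  "cat_path E (ds @ [d]) x z \<longleftrightarrow> (\<exists>T \<subseteq> rnbs E x. card T = d \<and> cat_path E ds (Max T) z)"
proof (induction ds arbitrary: z)
  case (Cons e ds)
  show ?case
    unfolding append_Cons cat_path.simps(2) Cons.IH by blast
qed auto

lemma forced_0_iff: "x \<in> forced 0 E es \<longleftrightarrow> (\<exists>z. cat_path E (rev es) x z)"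
proof (induction es arbitrary: x)
  case (Cons d es)
  show ?case
    unfolding rev.simps cat_path_snoc forced_0_Cons mem_Collect_eq Cons.IH by blast
next
  case Nil
  have "cat_path E [] x x" by simp
  then show ?case by auto
qed

section \<open>Caterpillar copies as increasing maps\<close>

lemma edges_rcat_Cons:
  "edges (rcat (d # ds)) = edges (rcat ds) \<union> (\<lambda>j. {sum_list ds, sum_list ds + j}) ` {1..d}"
proof -
  have v: "verts (rstar d) = {0..d}" "verts (rcat ds) = {0..sum_list ds}"
    using rcat_wf[of ds] by (simp_all add: rstar_def)
  have "edges (rstar d) = (\<lambda>j. {0, j}) ` {1..d}"
    by (auto simp: rstar_def)
  then have "(\<lambda>e. (\<lambda>v. v + sum_list ds) ` e) ` edges (rstar d) =
      (\<lambda>j. {sum_list ds, sum_list ds + j}) ` {1..d}"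
    by (simp add: image_image add.commute)
  then show ?thesis
    by (simp add: concatenation_def Let_def v Min_Max_atMost)
qed

declare rcat.simps(2) [simp del]

lemma verts_rcat: "verts (rcat ds) = {0..sum_list ds}"
  using rcat_wf by simp

lemma edge_rcat_subset: "e \<in> edges (rcat ds) \<Longrightarrow> e \<subseteq> {0..sum_list ds}"
  using rcat_wf[of ds] unfolding ordered_graph_def verts_rcat by blast

lemma finite_edges: "ordered_graph F \<Longrightarrow> finite (edges F)"
  by (rule finite_subset[of _ "Pow (verts F)"]) (auto simp: ordered_graph_def)

text \<open>Glue the map of the shorter caterpillar to the increasing enumeration of the leaves of
  the last star. Prescribing the end values makes the pieces meet at the centre
  \<open>y\<close>.\<close>

lemma cat_path_embedding:
  assumes "cat_path E ds x z" "\<forall>d \<in> set ds. 1 \<le> d"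
  shows "\<exists>f. strict_mono_on {0..sum_list ds} f \<and> f 0 = x \<and> f (sum_list ds) = z \<and>
    (\<forall>e \<in> edges (rcat ds). f ` e \<in> E)"
  using assms
proof (induction ds arbitrary: z)
  case Nil
  then show ?case
    by (intro exI[of _ "\<lambda>_. x"]) (auto simp: rstar_def strict_mono_on_def)
next
  case (Cons d ds)
  let ?s = "sum_list ds"
  obtain y T where y: "cat_path E ds x y" and T: "T \<subseteq> rnbs E y" "card T = d" "Max T = z"
    using Cons.prems(1) by auto
  have d: "1 \<le> d" using Cons.prems(2) by simp
  with T(2) have finT: "finite T" "T \<noteq> {}" by (auto intro: card_ge_0_finite)
  from Cons.IH[OF y] Cons.prems(2) obtain f where f: "strict_mono_on {0..?s} f" "f 0 = x" "f ?s = y"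
    "\<And>e. e \<in> edges (rcat ds) \<Longrightarrow> f ` e \<in> E"
    by auto
  obtain g where g: "bij_betw g {..<d} T" "strict_mono_on {..<d} g"
    using ex_bij_betw_strict_mono_card[OF finT(1)] T(2) by blast
  \<comment> \<open>The vertex \<open>?s\<close> is the centre and belongs to \<open>f\<close>, so
    the leaves start at \<open>Suc ?s\<close>, where \<open>g\<close> is evaluated at 0.\<close>
  let ?h = "\<lambda>v. if v \<le> ?s then f v else g (v - Suc ?s)"
  have gT: "g v \<in> rnbs E y" if "v < d" for v
    using g(1) T(1) that by (auto simp: bij_betw_def)
  have mono: "strict_mono_on {0..sum_list (d # ds)} ?h"
  proof (rule strict_mono_onI)
    fix u v assume uv: "u \<in> {0..sum_list (d # ds)}" "v \<in> {0..sum_list (d # ds)}" "u < v"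
    consider "v \<le> ?s" | "u \<le> ?s" "?s < v" | "?s < u" by linarith
    then show "?h u < ?h v"
    proof cases
      case 1
      then show ?thesis using strict_mono_onD[OF f(1), of u v] uv by simp
    next
      case 2
      have "f u \<le> f ?s"
        using strict_mono_on_leD[OF f(1), of u ?s] 2 by simp
      also have "\<dots> < g (v - Suc ?s)"
        using gT[of "v - Suc ?s"] f(3) uv 2 by (auto simp: rnbs_def)
      finally show ?thesis using 2 by simp
    next
      case 3
      then show ?thesis using strict_mono_onD[OF g(2), of "u - Suc ?s" "v - Suc ?s"] uv by auto
    qed
  qed
  have "g (d - 1) = Max T"
  proof (rule Max_eqI[symmetric])
    show "t \<le> g (d - 1)" if t: "t \<in> T" for t
    proof -
      from t g(1) obtain i where "i < d" "t = g i" by (auto simp: bij_betw_def)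
      then show ?thesis using strict_mono_on_leD[OF g(2), of i "d - 1"] by auto
    qed
    show "g (d - 1) \<in> T" using g(1) d by (auto simp: bij_betw_def)
  qed (rule finT)
  then have "?h (sum_list (d # ds)) = z"
    using T(3) d by auto
  moreover have "?h 0 = x" using f(2) by simp
  moreover have "?h ` e \<in> E" if "e \<in> edges (rcat (d # ds))" for e
    using that unfolding edges_rcat_Cons
  proof (elim UnE imageE)
    assume e: "e \<in> edges (rcat ds)"
    then have "?h ` e = f ` e"
      using edge_rcat_subset[OF e] by (intro image_cong) auto
    with f(4)[OF e] show ?thesis by simp
  next
    fix j assume j: "j \<in> {1..d}" and e: "e = {?s, ?s + j}"
    then have "?h ` e = {y, g (j - 1)}"
      using f(3) by auto
    with gT[of "j - 1"] j show ?thesis by (auto simp: rnbs_def)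
  qed
  ultimately show ?case using mono by (intro exI[of _ ?h] conjI) simp_all
qed

lemma embedding_cat_path:
  assumes "strict_mono_on {0..sum_list ds} f" "\<forall>e \<in> edges (rcat ds). f ` e \<in> E"
    "\<forall>d \<in> set ds. 1 \<le> d"
  shows "cat_path E ds (f 0) (f (sum_list ds))"
  using assms
proof (induction ds)
  case (Cons d ds)
  let ?s = "sum_list ds"
  have "cat_path E ds (f 0) (f ?s)"
  proof (rule Cons.IH)
    show "strict_mono_on {0..?s} f"
      using Cons.prems(1) by (auto simp: strict_mono_on_def)
  qed (use Cons.prems in \<open>auto simp: edges_rcat_Cons\<close>)
  moreover have "\<exists>T \<subseteq> rnbs E (f ?s). card T = d \<and> Max T = f (sum_list (d # ds))"
  proof (intro exI conjI)
    let ?T = "f ` {?s + 1..?s + d}"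
    have less: "f u < f v" if "u < v" "v \<le> ?s + d" for u v
      using strict_mono_onD[OF Cons.prems(1), of u v] that by auto
    show "?T \<subseteq> rnbs E (f ?s)"
    proof
      fix t assume "t \<in> ?T"
      then obtain v where v: "t = f v" "?s + 1 \<le> v" "v \<le> ?s + d" by auto
      then have "{?s, v} \<in> edges (rcat (d # ds))"
        unfolding edges_rcat_Cons by (intro UnI2 image_eqI[of _ _ "v - ?s"]) auto
      with Cons.prems(2) have "f ` {?s, v} \<in> E" by blast
      with v less[of ?s v] show "t \<in> rnbs E (f ?s)" by (auto simp: rnbs_def)
    qed
    have "inj_on f {?s + 1..?s + d}"
      by (rule inj_on_subset[OF strict_mono_on_imp_inj_on[OF Cons.prems(1)]]) auto
    then show "card ?T = d" by (simp add: card_image)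
    show "Max ?T = f (sum_list (d # ds))"
    proof (rule Max_eqI)
      show "f (sum_list (d # ds)) \<in> ?T" using Cons.prems(3) by auto
      show "t \<le> f (sum_list (d # ds))" if "t \<in> ?T" for t
        using that less[of _ "?s + d"] by (auto simp: add.commute le_less)
    qed simp
  qed
  ultimately show ?case by auto
qed simp

text \<open>With no isolated vertices, a map that sends edges into \<open>F\<close> also sends
  vertices into \<open>F\<close>.\<close>

lemma rcat_vertex_in_edge:
  assumes "v \<in> verts (rcat ds)" "ds \<noteq> []" "\<forall>d \<in> set ds. 1 \<le> d"
  shows "\<exists>e \<in> edges (rcat ds). v \<in> e"
  using assms
proof (induction ds)
  case (Cons d ds)
  let ?s = "sum_list ds"
  have edge: "{?s, ?s + j} \<in> edges (rcat (d # ds))" if "1 \<le> j" "j \<le> d" for j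
    using that by (auto simp: edges_rcat_Cons)
  have v: "v \<le> d + ?s" using Cons.prems(1) by (simp add: verts_rcat)
  consider "v < ?s" | "v = ?s" | "?s < v" by linarith
  then show ?case
  proof cases
    case 1
    then have "ds \<noteq> []" by auto
    with 1 Cons obtain e where "e \<in> edges (rcat ds)" "v \<in> e"
      by (auto simp: verts_rcat)
    then show ?thesis by (auto simp: edges_rcat_Cons)
  next
    case 2
    then show ?thesis using edge[of 1] Cons.prems(3) by (intro bexI[of _ "{?s, ?s + 1}"]) auto
  next
    case 3
    then show ?thesis using edge[of "v - ?s"] v by (intro bexI[of _ "{?s, v}"]) auto
  qed
qed simp

text \<open>\<open>P\<close> stands for having a given colour. Copies are images of increasing maps,
  which correspond to \<open>cat_path\<close>; \<open>rev\<close> converts between the two list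
  orders.\<close>

lemma copy_rcat_iff:
  assumes F: "ordered_graph F" and ds: "ds \<noteq> []" "\<forall>d \<in> set ds. 1 \<le> d"
  shows "(\<exists>K. is_copy (rcat ds) F K \<and> (\<forall>e \<in> edges K. P e)) \<longleftrightarrow>
    forced 0 {e \<in> edges F. P e} (rev ds) \<noteq> {}" (is "?L \<longleftrightarrow> ?R")
proof
  assume ?L
  then obtain K f where K: "subgraph K F" "\<forall>e \<in> edges K. P e"
    and f: "strict_mono_on (verts (rcat ds)) f" "edges K = (\<lambda>e. f ` e) ` edges (rcat ds)"
    unfolding is_copy_def order_iso_def by blast
  have "cat_path {e \<in> edges F. P e} ds (f 0) (f (sum_list ds))"
  proof (rule embedding_cat_path)
    show "strict_mono_on {0..sum_list ds} f" using f(1) by (simp add: verts_rcat)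
    show "\<forall>e \<in> edges (rcat ds). f ` e \<in> {e \<in> edges F. P e}"
      using K f(2) by (auto simp: subgraph_def)
  qed (rule ds)
  then have "f 0 \<in> forced 0 {e \<in> edges F. P e} (rev ds)"
    by (auto simp: forced_0_iff)
  then show ?R by blast
next
  assume ?R
  then obtain x z where "cat_path {e \<in> edges F. P e} ds x z"
    by (auto simp: forced_0_iff)
  from cat_path_embedding[OF this ds(2)]
  obtain f where f: "strict_mono_on (verts (rcat ds)) f"
    and fe: "\<And>e. e \<in> edges (rcat ds) \<Longrightarrow> f ` e \<in> edges F \<and> P (f ` e)"
    by (auto simp: verts_rcat)
  have inj: "inj_on f (verts (rcat ds))"
    using f by (rule strict_mono_on_imp_inj_on)
  let ?K = "OGraph (f ` verts (rcat ds)) ((\<lambda>e. f ` e) ` edges (rcat ds))"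
  have "order_iso (rcat ds) ?K"
    unfolding order_iso_def using f inj by (intro exI[of _ f]) (auto simp: bij_betw_def)
  moreover have "subgraph ?K F"
    unfolding subgraph_def
  proof (intro conjI F)
    show "edges ?K \<subseteq> edges F" using fe by auto
    then have "card e = 2" if "e \<in> edges ?K" for e
      using F that by (auto simp: ordered_graph_def)
    moreover have "e \<subseteq> verts ?K" if "e \<in> edges ?K" for e
      using that edge_rcat_subset by (auto simp: verts_rcat)
    ultimately show "ordered_graph ?K"
      by (simp add: ordered_graph_def verts_rcat)
    show "verts ?K \<subseteq> verts F"
    proof
      fix w assume "w \<in> verts ?K"
      then obtain v where v: "v \<in> verts (rcat ds)" "w = f v" by auto
      from rcat_vertex_in_edge[OF v(1) ds] obtain e where "e \<in> edges (rcat ds)" "v \<in> e" ..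
      with v have "w \<in> f ` e" "f ` e \<in> edges F" using fe[of e] by auto
      moreover from this F have "f ` e \<subseteq> verts F" by (simp add: ordered_graph_def)
      ultimately show "w \<in> verts F" by blast
    qed
  qed
  ultimately have "is_copy (rcat ds) F ?K \<and> (\<forall>e \<in> edges ?K. P e)"
    using fe by (auto simp: is_copy_def)
  then show ?L ..
qed

section \<open>Ramsey graphs of a right star and a right caterpillar\<close>

text \<open>The star is treated as the caterpillar \<open>[Suc r]\<close>, so both kinds of copies
  reduce to \<open>forced 0\<close>. Without a red star, a vertex has at most \<open>r\<close> red
  right neighbours.\<close>

lemma ramsey_iff_forced:
  assumes F: "ordered_graph F" and ds: "ds \<noteq> []" "\<forall>d \<in> set ds. 1 \<le> d"
  shows "F \<in> ramsey_graphs (rstar (Suc r)) (rcat ds) \<longleftrightarrow>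
    (\<forall>c. (\<exists>x. \<exists>T \<subseteq> rnbs {e \<in> edges F. c e = Red} x. card T = Suc r) \<or>
         forced 0 {e \<in> edges F. c e = Blue} (rev ds) \<noteq> {})"
proof -
  have "(\<exists>K. is_copy (rstar (Suc r)) F K \<and> (\<forall>e \<in> edges K. c e = Red)) \<longleftrightarrow>
      (\<exists>x. \<exists>T \<subseteq> rnbs {e \<in> edges F. c e = Red} x. card T = Suc r)" for c
    using copy_rcat_iff[OF F, of "[Suc r]" "\<lambda>e. c e = Red"]
    by (simp add: rcat_single forced_0_Cons)
  with copy_rcat_iff[OF F ds] F show ?thesis
    by (simp add: ramsey_graphs_def)
qed

text \<open>More than \<open>r\<close> red right neighbours at some vertex give a red star.
  Otherwise the red neighbours are an admissible deletion at every vertex, and a forced vertex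
  starts a blue caterpillar.\<close>

lemma ramsey_if_forced:
  assumes F: "ordered_graph F" and ds: "ds \<noteq> []" "\<forall>d \<in> set ds. 1 \<le> d"
    and x: "x \<in> forced r (edges F) (rev ds)"
  shows "F \<in> ramsey_graphs (rstar (Suc r)) (rcat ds)"
  unfolding ramsey_iff_forced[OF F ds]
proof
  fix c :: "nat set \<Rightarrow> colour"
  let ?red = "rnbs {e \<in> edges F. c e = Red}"
  show "(\<exists>x. \<exists>T \<subseteq> ?red x. card T = Suc r) \<or>
         forced 0 {e \<in> edges F. c e = Blue} (rev ds) \<noteq> {}"
  proof (cases "\<exists>x. Suc r \<le> card (?red x)")
    case True
    then show ?thesis by (meson obtain_subset_with_card_n)
  next
    case False
    have "finite (?red x)" for x
      using finite_edges[OF F] by (intro finite_rnbs) simp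
    with False have "finite (?red x) \<and> card (?red x) \<le> r" for x
      by (auto simp: not_less_eq_eq)
    moreover have "rnbs (edges F) x - rnbs {e \<in> edges F. c e = Blue} x \<subseteq> ?red x" for x
      by (auto simp: rnbs_def intro: colour.exhaust)
    ultimately have "forced r (edges F) (rev ds) \<subseteq> forced 0 {e \<in> edges F. c e = Blue} (rev ds)"
      by (intro forced_remove)
    with x show ?thesis by blast
  qed
qed

lemma forced_if_ramsey:
  assumes F: "F \<in> ramsey_graphs (rstar (Suc r)) (rcat ds)"
    and ds: "ds \<noteq> []" "\<forall>d \<in> set ds. 1 \<le> d" "length ds \<le> 2 \<or> sorted ds"
  shows "forced r (edges F) (rev ds) \<noteq> {}"
proof
  assume empty: "forced r (edges F) (rev ds) = {}"
  have G: "ordered_graph F" using F by (simp add: ramsey_graphs_def)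
  have "\<exists>R. avoids r (edges F) x R (rev ds)" for x
  proof (cases "sorted ds")
    case True
    then show ?thesis
      using ds(2) by (intro avoids_sorted) (simp_all add: sorted_wrt_rev)
  next
    case False
    \<comment> \<open>A one-element list is sorted, so exactly two entries remain.\<close>
    with ds obtain a b where "ds = [a, b]"
      by (cases ds; cases "tl ds") auto
    then show ?thesis
      using avoids_two[OF finite_edges[OF G], of x r b a] empty by simp
  qed
  then obtain R where R: "\<And>x. avoids r (edges F) x (R x) (rev ds)"
    by metis
  \<comment> \<open>An edge is red if the deletion set of its left end contains its right end. The
    sets \<open>R x\<close> for different \<open>x\<close> therefore do not interfere.\<close>
  define c where "c e = (if \<exists>x y. e = {x, y} \<and> x < y \<and> y \<in> R x then Red else Blue)" for e
  have red: "rnbs {e \<in> edges F. c e = Red} x \<subseteq> R x" for x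
    by (auto simp: rnbs_def c_def doubleton_eq_iff split: if_splits)
  have blue: "rnbs {e \<in> edges F. c e = Blue} x \<subseteq> rnbs (edges F) x - R x" for x
    by (auto simp: rnbs_def c_def split: if_splits)
  have small: "card T \<le> r" if "T \<subseteq> rnbs {e \<in> edges F. c e = Red} x" for x T
  proof -
    have "finite (R x)" "card (R x) \<le> r"
      using R[of x] by (simp_all add: avoids_def)
    then show ?thesis
      using card_mono[of "R x" T] that red[of x] by (meson order_trans)
  qed
  have "forced 0 {e \<in> edges F. c e = Blue} (rev ds) \<subseteq> forced r (edges F) (rev ds)"
    using R blue by (rule forced_0_subset)
  with F empty obtain x T where "T \<subseteq> rnbs {e \<in> edges F. c e = Red} x" "card T = Suc r"
    unfolding ramsey_iff_forced[OF G ds(1,2)] by (elim allE[of _ c]) auto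
  with small[of T x] show False by simp
qed

section \<open>Isomorphism and bounded subgraphs\<close>

lemma order_iso_sym:
  assumes "order_iso G G'" "ordered_graph G"
  shows "order_iso G' G"
proof -
  from assms(1) obtain f where f: "bij_betw f (verts G) (verts G')" "strict_mono_on (verts G) f"
    "edges G' = (\<lambda>e. f ` e) ` edges G"
    unfolding order_iso_def by blast
  let ?g = "inv_into (verts G) f"
  have g: "?g (f v) = v" if "v \<in> verts G" for v
    using f(1) that by (simp add: bij_betw_def)
  have "strict_mono_on (verts G') ?g"
  proof (rule strict_mono_onI)
    fix a b assume ab: "a \<in> verts G'" "b \<in> verts G'" "a < b"
    then obtain u v where uv: "u \<in> verts G" "v \<in> verts G" "a = f u" "b = f v"
      using bij_betw_imp_surj_on[OF f(1)] by blast
    with ab f(2) have "u < v"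
      by (simp add: strict_mono_on_less)
    with uv g show "?g a < ?g b" by simp
  qed
  moreover have "edges G = (\<lambda>e. ?g ` e) ` edges G'"
  proof -
    have "?g ` f ` e = e" if "e \<in> edges G" for e
    proof -
      have "e \<subseteq> verts G" using assms(2) that by (simp add: ordered_graph_def)
      then show ?thesis using g by (force simp: image_image)
    qed
    then show ?thesis unfolding f(3) image_image by simp
  qed
  ultimately show ?thesis
    unfolding order_iso_def using bij_betw_inv_into[OF f(1)] by blast
qed

lemma order_iso_trans:
  assumes "order_iso G1 G2" "order_iso G2 G3"
  shows "order_iso G1 G3"
proof -
  from assms(1) obtain f where f: "bij_betw f (verts G1) (verts G2)" "strict_mono_on (verts G1) f"
    "edges G2 = (\<lambda>e. f ` e) ` edges G1"
    unfolding order_iso_def by blast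
  from assms(2) obtain g where g: "bij_betw g (verts G2) (verts G3)" "strict_mono_on (verts G2) g"
    "edges G3 = (\<lambda>e. g ` e) ` edges G2"
    unfolding order_iso_def by blast
  have "f v \<in> verts G2" if "v \<in> verts G1" for v
    using f(1) that by (auto simp: bij_betw_def)
  then have "strict_mono_on (verts G1) (g \<circ> f)"
    using f(2) g(2) by (simp add: strict_mono_on_def)
  moreover have "edges G3 = (\<lambda>e. (g \<circ> f) ` e) ` edges G1"
    unfolding f(3) g(3) by (simp add: image_image)
  ultimately show ?thesis
    unfolding order_iso_def using bij_betw_trans[OF f(1) g(1)] by blast
qed

lemma ordered_graph_order_iso:
  assumes "order_iso G G'" "ordered_graph G"
  shows "ordered_graph G'"
proof -
  from assms(1) obtain f where f: "bij_betw f (verts G) (verts G')"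
    "edges G' = (\<lambda>e. f ` e) ` edges G"
    unfolding order_iso_def by blast
  have "f ` e \<subseteq> verts G' \<and> card (f ` e) = 2" if "e \<in> edges G" for e
  proof -
    have e: "e \<subseteq> verts G" "card e = 2"
      using assms(2) that by (simp_all add: ordered_graph_def)
    then have "inj_on f e"
      using f(1) by (auto simp: bij_betw_def intro: inj_on_subset)
    with e f(1) show ?thesis
      by (auto simp: card_image bij_betw_def)
  qed
  moreover have "finite (verts G')"
    using assms(2) bij_betw_finite[OF f(1)] by (simp add: ordered_graph_def)
  ultimately show ?thesis
    unfolding ordered_graph_def f(2) by blast
qed

lemma is_copy_order_iso:
  assumes "order_iso H G" "ordered_graph H"
  shows "is_copy H F K \<longleftrightarrow> is_copy G F K"
  unfolding is_copy_def
  using order_iso_trans[OF assms(1)] order_iso_trans[OF order_iso_sym[OF assms]] by blast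

lemma ramsey_graphs_order_iso:
  assumes "order_iso H G" "ordered_graph H" "order_iso H' G'" "ordered_graph H'"
  shows "ramsey_graphs H H' = ramsey_graphs G G'"
  unfolding ramsey_graphs_def is_copy_order_iso[OF assms(1,2)] is_copy_order_iso[OF assms(3,4)] ..

text \<open>A minimal Ramsey graph is its own core, so this yields finiteness, and it transfers
  easily to isomorphic and to reflected pairs.\<close>

definition bounded_cores :: "ograph \<Rightarrow> ograph \<Rightarrow> bool" where
  "bounded_cores H H' \<longleftrightarrow> (\<exists>N. \<forall>F \<in> ramsey_graphs H H'. \<exists>K \<in> ramsey_graphs H H'.
     subgraph K F \<and> card (verts K) \<le> N)"

lemma order_iso_initial_segment:
  assumes "ordered_graph F"
  shows "\<exists>G. order_iso G F \<and> verts G = {..<card (verts F)} \<and> edges G \<subseteq> Pow (verts G)"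
proof -
  let ?I = "{..<card (verts F)}"
  obtain h where h: "bij_betw h ?I (verts F)" "strict_mono_on ?I h"
    using ex_bij_betw_strict_mono_card assms unfolding ordered_graph_def by metis
  let ?G = "OGraph ?I {e \<in> Pow ?I. h ` e \<in> edges F}"
  have "edges F = (\<lambda>e. h ` e) ` edges ?G"
  proof
    show "edges F \<subseteq> (\<lambda>e. h ` e) ` edges ?G"
    proof
      fix e assume e: "e \<in> edges F"
      then have "e \<subseteq> h ` ?I"
        using assms h(1) by (simp add: ordered_graph_def bij_betw_def)
      then obtain e' where "e' \<subseteq> ?I" "e = h ` e'"
        unfolding subset_image_iff by blast
      with e show "e \<in> (\<lambda>e. h ` e) ` edges ?G" by simp
    qed
  qed auto
  with h have "order_iso ?G F"
    unfolding order_iso_def by (intro exI[of _ h]) simp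
  then show ?thesis by (intro exI[of _ ?G]) auto
qed

lemma ramsey_finite_if_bounded_cores:
  assumes "bounded_cores H H'"
  shows "ramsey_finite H H'"
proof -
  from assms obtain N where N: "\<And>F. F \<in> ramsey_graphs H H' \<Longrightarrow>
      \<exists>K \<in> ramsey_graphs H H'. subgraph K F \<and> card (verts K) \<le> N"
    unfolding bounded_cores_def by blast
  let ?iso = "{(F, F'). order_iso F F'}"
  let ?S = "(\<lambda>(V, E). OGraph V E) ` (Pow {..<N} \<times> Pow (Pow {..<N}))"
  have "minimal_ramsey_graphs H H' // ?iso \<subseteq> (\<lambda>G. ?iso `` {G}) ` ?S"
  proof
    fix X assume "X \<in> minimal_ramsey_graphs H H' // ?iso"
    then obtain F where F: "F \<in> minimal_ramsey_graphs H H'" and X: "X = ?iso `` {F}"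
      by (rule quotientE)
    have "F \<in> ramsey_graphs H H'"
      using F by (simp add: minimal_ramsey_graphs_def)
    \<comment> \<open>By minimality the small Ramsey subgraph is \<open>F\<close> itself.\<close>
    from N[OF this] F have card: "card (verts F) \<le> N"
      by (auto simp: minimal_ramsey_graphs_def)
    have og: "ordered_graph F"
      using F by (simp add: minimal_ramsey_graphs_def ramsey_graphs_def)
    from order_iso_initial_segment[OF this] obtain G where
      G: "order_iso G F" "verts G = {..<card (verts F)}" "edges G \<subseteq> Pow (verts G)"
      by blast
    have "verts G \<subseteq> {..<N}"
      using G(2) card by auto
    moreover have "edges G \<subseteq> Pow {..<N}"
      using G(3) calculation by blast
    ultimately have "G \<in> ?S"
      by (intro image_eqI[of _ _ "(verts G, edges G)"]) auto
    moreover have FG: "order_iso F G"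
    proof (rule order_iso_sym[OF G(1)])
      from G(1) obtain f where f: "bij_betw f (verts G) (verts F)" "edges F = (\<lambda>e. f ` e) ` edges G"
        unfolding order_iso_def by blast
      have "card e = 2" if e: "e \<in> edges G" for e
      proof -
        have "inj_on f e"
          using f(1) G(3) e by (auto simp: bij_betw_def intro: inj_on_subset)
        then have "card e = card (f ` e)" by (simp add: card_image)
        with og f(2) e show ?thesis by (simp add: ordered_graph_def)
      qed
      with G(2,3) show "ordered_graph G"
        by (auto simp: ordered_graph_def)
    qed
    \<comment> \<open>A class is the image of \<open>F\<close> under the relation on all graphs. The
      representative \<open>G\<close> has the same image, and only finitely many \<open>G\<close>
      lie in \<open>?S\<close>.\<close>
    have "order_iso F K \<longleftrightarrow> order_iso G K" for K
      using order_iso_trans[OF G(1)] order_iso_trans[OF FG] by blast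
    then have "X = ?iso `` {G}"
      unfolding X by simp
    ultimately show "X \<in> (\<lambda>G. ?iso `` {G}) ` ?S" by blast
  qed
  moreover have "finite ((\<lambda>G. ?iso `` {G}) ` ?S)"
    by simp
  ultimately show ?thesis
    unfolding ramsey_finite_def by (rule finite_subset)
qed

section \<open>Right stars with right caterpillars\<close>

lemma right_star_order_iso:
  assumes "right_star H"
  shows "\<exists>p. order_iso (rstar p) H"
proof -
  from assms obtain c where fin: "finite (verts H)" and c: "c \<in> verts H"
    "edges H = {{c, v} | v. v \<in> verts H - {c}}" "\<forall>v \<in> verts H - {c}. c < v"
    by (auto simp: right_star_def ordered_graph_def)
  let ?p = "card (verts H - {c})"
  obtain g where g: "bij_betw g {..<?p} (verts H - {c})" "strict_mono_on {..<?p} g"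
    using ex_bij_betw_strict_mono_card[of "verts H - {c}"] fin by blast
  let ?f = "\<lambda>v. if v = 0 then c else g (v - 1)"
  have im: "?f ` {1..?p} = verts H - {c}"
  proof -
    have "?f ` {1..?p} = g ` (\<lambda>v. v - 1) ` {1..?p}"
      unfolding image_image by (rule image_cong) auto
    also have "(\<lambda>v. v - 1) ` {1..?p} = {..<?p}"
      by (force simp: image_iff intro: bexI[of _ "Suc _"])
    finally show ?thesis using g(1) by (simp add: bij_betw_def)
  qed
  have mono: "strict_mono_on {0..?p} ?f"
  proof (rule strict_mono_onI)
    fix u v assume uv: "u \<in> {0..?p}" "v \<in> {0..?p}" "u < v"
    show "?f u < ?f v"
    proof (cases "u = 0")
      case True
      with uv have "?f v \<in> ?f ` {1..?p}" by (intro imageI) auto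
      then have "?f v \<in> verts H - {c}" unfolding im .
      with c(3) True show ?thesis by simp
    next
      case False
      with uv show ?thesis using strict_mono_onD[OF g(2), of "u - 1" "v - 1"] by auto
    qed
  qed
  have "{0..?p} = insert 0 {1..?p}" by auto
  then have "?f ` {0..?p} = insert c (?f ` {1..?p})"
    by (simp only: image_insert if_True simp_thms)
  then have "?f ` {0..?p} = verts H"
    unfolding im using c(1) by auto
  then have "bij_betw ?f (verts (rstar ?p)) (verts H)"
    using strict_mono_on_imp_inj_on[OF mono] by (simp add: bij_betw_def rstar_def)
  moreover have "edges H = (\<lambda>e. ?f ` e) ` edges (rstar ?p)"
  proof -
    have "edges H = (\<lambda>v. {c, v}) ` ?f ` {1..?p}"
      unfolding im c(2) by blast
    also have "\<dots> = (\<lambda>v. ?f ` {0, v}) ` {1..?p}"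
      by (simp add: image_image insert_commute)
    also have "\<dots> = (\<lambda>e. ?f ` e) ` (\<lambda>v. {0, v}) ` {1..?p}"
      by (simp only: image_image)
    also have "(\<lambda>v. {0, v}) ` {1..?p} = edges (rstar ?p)"
      by (auto simp: rstar_def)
    finally show ?thesis .
  qed
  ultimately show ?thesis
    using mono unfolding order_iso_def by (intro exI[of _ ?p] exI[of _ ?f]) (simp add: rstar_def)
qed

text \<open>For \<open>p = Suc r\<close>, a Ramsey graph has a forced vertex with a witness of at
  most \<open>n\<close> edges, and these edges span a Ramsey graph on at most \<open>n * 2\<close>
  vertices.\<close>

lemma bounded_cores_rstar_rcat:
  assumes ds: "ds \<noteq> []" "\<forall>d \<in> set ds. 1 \<le> d" "length ds \<le> 2 \<or> sorted ds"
  shows "bounded_cores (rstar p) (rcat ds)"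
proof (cases p)
  case 0
  \<comment> \<open>The star without edges is a single vertex, so any vertex of \<open>F\<close>
    alone is vacuously a red copy. \<open>F\<close> has a vertex because it contains some
    copy.\<close>
  have "\<exists>K \<in> ramsey_graphs (rstar 0) (rcat ds). subgraph K F \<and> card (verts K) \<le> 1"
    if F: "F \<in> ramsey_graphs (rstar 0) (rcat ds)" for F
  proof -
    have "verts K \<noteq> {}" if "order_iso G K" "verts G \<noteq> {}" for G K
      using that by (auto simp: order_iso_def bij_betw_def)
    moreover have "verts (rstar 0) \<noteq> {}" "verts (rcat ds) \<noteq> {}"
      by (simp_all add: rstar_def verts_rcat)
    moreover from F obtain K where "is_copy (rstar 0) F K \<or> is_copy (rcat ds) F K"
      unfolding ramsey_graphs_def by blast
    ultimately obtain v where v: "v \<in> verts F"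
      unfolding is_copy_def subgraph_def by blast
    let ?K = "OGraph {v} {}"
    have K: "ordered_graph ?K" by (simp add: ordered_graph_def)
    have "order_iso (rstar 0) ?K"
      unfolding order_iso_def
      by (intro exI[of _ "\<lambda>_. v"]) (auto simp: rstar_def bij_betw_def strict_mono_on_def)
    with K have "is_copy (rstar 0) ?K ?K"
      by (simp add: is_copy_def subgraph_def)
    moreover have "\<forall>e \<in> edges ?K. c e = Red" for c by simp
    ultimately have "?K \<in> ramsey_graphs (rstar 0) (rcat ds)"
      unfolding ramsey_graphs_def using K by blast
    moreover have "subgraph ?K F"
      using v K F by (simp add: subgraph_def ramsey_graphs_def)
    ultimately show ?thesis by (intro bexI[of _ ?K]) auto
  qed
  then show ?thesis unfolding bounded_cores_def 0 by blast
next
  case (Suc r)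
  from forced_witness[of "rev ds" r] ds(2)
  obtain n where n: "\<forall>E x. x \<in> forced r E (rev ds) \<longrightarrow>
    (\<exists>W \<subseteq> E. finite W \<and> card W \<le> n \<and> x \<in> forced r W (rev ds))"
    by auto
  have "\<exists>K \<in> ramsey_graphs (rstar (Suc r)) (rcat ds). subgraph K F \<and> card (verts K) \<le> n * 2"
    if F: "F \<in> ramsey_graphs (rstar (Suc r)) (rcat ds)" for F
  proof -
    have og: "ordered_graph F" using F by (simp add: ramsey_graphs_def)
    from forced_if_ramsey[OF F ds] obtain x where "x \<in> forced r (edges F) (rev ds)" by blast
    with n obtain W where W: "W \<subseteq> edges F" "finite W" "card W \<le> n" "x \<in> forced r W (rev ds)"
      by blast
    have e: "e \<subseteq> verts F" "card e = 2" "finite e" if "e \<in> W" for e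
      using og W(1) that by (auto simp: ordered_graph_def intro: finite_subset)
    let ?K = "OGraph (\<Union>W) W"
    have K: "ordered_graph ?K"
      using W(2) e by (auto simp: ordered_graph_def)
    then have "?K \<in> ramsey_graphs (rstar (Suc r)) (rcat ds)"
      using ramsey_if_forced[OF K ds(1,2)] W(4) by simp
    moreover have "subgraph ?K F"
      using K og W(1) e(1) by (auto simp: subgraph_def)
    moreover have "card (\<Union>W) \<le> n * 2"
    proof -
      have "card (\<Union>W) \<le> (\<Sum>e \<in> W. card e)"
        by (rule card_Union_le_sum_card)
      also have "\<dots> = card W * 2"
        using e(2) by simp
      finally show ?thesis using W(3) by simp
    qed
    ultimately show ?thesis by (intro bexI[of _ ?K]) auto
  qed
  then show ?thesis unfolding bounded_cores_def Suc by blast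
qed

lemma bounded_cores_right:
  assumes "right_star H" "right_caterpillar ds H'" "length ds \<le> 2 \<or> sorted ds"
  shows "bounded_cores H H'"
proof -
  from right_star_order_iso[OF assms(1)] obtain p where "order_iso (rstar p) H" ..
  then have "ramsey_graphs (rstar p) (rcat ds) = ramsey_graphs H H'"
    using assms(2) rcat_wf[of ds] ordered_graph_rstar
    by (intro ramsey_graphs_order_iso) (simp_all add: right_caterpillar_def)
  with bounded_cores_rstar_rcat[of ds p] assms(2,3) show ?thesis
    by (simp add: bounded_cores_def right_caterpillar_def)
qed

section \<open>Reflection\<close>

text \<open>A bound \<open>m\<close> from outside, instead of the maximum used in
  \<open>mirror\<close>, reflects a graph and all its subgraphs by the same map. Subtraction
  truncates, so the vertices must be at most \<open>m\<close> for this to be an involution.\<close>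

definition reflect :: "nat \<Rightarrow> ograph \<Rightarrow> ograph" where
  "reflect m G = OGraph ((\<lambda>v. m - v) ` verts G) ((\<lambda>e. (\<lambda>v. m - v) ` e) ` edges G)"

lemma inj_on_reflect: "inj_on (\<lambda>v. m - v) {..m::nat}"
  by (auto simp: inj_on_def)

lemma reflect_reflect_set: "A \<subseteq> {..m::nat} \<Longrightarrow> (\<lambda>v. m - v) ` (\<lambda>v. m - v) ` A = A"
  by (force simp: image_image)

lemma verts_reflect_le: "verts (reflect m G) \<subseteq> {..m}"
  by (auto simp: reflect_def)

lemma card_verts_reflect: "verts G \<subseteq> {..m} \<Longrightarrow> card (verts (reflect m G)) = card (verts G)"
  by (simp add: reflect_def card_image inj_on_subset[OF inj_on_reflect])

lemma edge_le: "ordered_graph G \<Longrightarrow> verts G \<subseteq> {..m} \<Longrightarrow> e \<in> edges G \<Longrightarrow> e \<subseteq> {..m}"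
  unfolding ordered_graph_def by blast

lemma ordered_graph_reflect:
  assumes "ordered_graph G" "verts G \<subseteq> {..m}"
  shows "ordered_graph (reflect m G)"
proof -
  have "card ((\<lambda>v. m - v) ` e) = 2" if "e \<in> edges G" for e
    using inj_on_subset[OF inj_on_reflect edge_le[OF assms that]] assms(1) that
    by (simp add: card_image ordered_graph_def)
  then show ?thesis
    using assms(1) by (auto simp: ordered_graph_def reflect_def)
qed

lemma reflect_reflect:
  assumes "ordered_graph G" "verts G \<subseteq> {..m}"
  shows "reflect m (reflect m G) = G"
proof -
  have "(\<lambda>e. (\<lambda>v. m - v) ` e) ` (\<lambda>e. (\<lambda>v. m - v) ` e) ` edges G = edges G"
    using reflect_reflect_set[OF edge_le[OF assms]] unfolding image_image[of _ "\<lambda>e. _ ` e"] by simp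
  with reflect_reflect_set[OF assms(2)] show ?thesis
    by (simp add: reflect_def)
qed

lemma subgraph_reflect:
  assumes "subgraph K F" "verts F \<subseteq> {..m}"
  shows "subgraph (reflect m K) (reflect m F)"
proof -
  have "verts K \<subseteq> {..m}"
    using assms by (auto simp: subgraph_def)
  with assms have "ordered_graph (reflect m K)" "ordered_graph (reflect m F)"
    by (auto simp: subgraph_def intro: ordered_graph_reflect)
  with assms(1) show ?thesis
    unfolding subgraph_def reflect_def by (simp add: image_mono)
qed

lemma order_iso_reflect:
  assumes "order_iso G G'" "ordered_graph G" "verts G \<subseteq> {..m}" "verts G' \<subseteq> {..m'}"
  shows "order_iso (reflect m G) (reflect m' G')"
proof -
  from assms(1) obtain f where f: "bij_betw f (verts G) (verts G')" "strict_mono_on (verts G) f"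
    "edges G' = (\<lambda>e. f ` e) ` edges G"
    unfolding order_iso_def by blast
  \<comment> \<open>This is \<open>f\<close> conjugated by the two reflections; the order is
    reversed twice.\<close>
  let ?h = "\<lambda>u. m' - f (m - u)"
  have h: "?h ` (\<lambda>v. m - v) ` A = (\<lambda>v. m' - v) ` f ` A" if "A \<subseteq> {..m}" for A
    unfolding image_image using that by (intro image_cong) auto
  have mono: "strict_mono_on (verts (reflect m G)) ?h"
  proof (rule strict_mono_onI)
    fix a b assume ab: "a \<in> verts (reflect m G)" "b \<in> verts (reflect m G)" "a < b"
    then obtain u v where uv: "u \<in> verts G" "v \<in> verts G" "a = m - u" "b = m - v"
      by (auto simp: reflect_def)
    with ab(3) have "v < u" by simp
    with f(2) uv have "f v < f u" by (simp add: strict_mono_on_def)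
    moreover have "f u \<le> m'"
      using f(1) uv(1) assms(4) by (auto simp: bij_betw_def)
    moreover have "m - a = u" "m - b = v"
      using uv assms(3) by auto
    ultimately show "?h a < ?h b" by simp
  qed
  moreover have "?h ` verts (reflect m G) = verts (reflect m' G')"
    using h[OF assms(3)] f(1) by (simp add: reflect_def bij_betw_def)
  moreover have "edges (reflect m' G') = (\<lambda>e. ?h ` e) ` edges (reflect m G)"
  proof -
    have "(\<lambda>e. ?h ` e) ` edges (reflect m G) = (\<lambda>e. ?h ` (\<lambda>v. m - v) ` e) ` edges G"
      by (simp only: reflect_def ograph.sel image_image)
    also have "\<dots> = (\<lambda>e. (\<lambda>v. m' - v) ` f ` e) ` edges G"
      using h[OF edge_le[OF assms(2,3)]] by (rule image_cong[OF refl])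
    also have "\<dots> = edges (reflect m' G')"
      by (simp only: reflect_def ograph.sel f(3) image_image)
    finally show ?thesis ..
  qed
  ultimately show ?thesis
    unfolding order_iso_def bij_betw_def
    using strict_mono_on_imp_inj_on[OF mono] by blast
qed

lemma is_copy_reflect:
  assumes "is_copy H F K" "verts F \<subseteq> {..m}" "ordered_graph H" "verts H \<subseteq> {..k}"
  shows "is_copy (reflect k H) (reflect m F) (reflect m K)"
  using assms subgraph_reflect[of K F m] order_iso_reflect[of H K k m]
  by (auto simp: is_copy_def subgraph_def)

text \<open>Pull a colouring of the reflected graph back to \<open>F\<close>, find a monochromatic
  copy there and reflect it.\<close>

lemma ramsey_graphs_reflect:
  assumes F: "F \<in> ramsey_graphs H H'" "verts F \<subseteq> {..m}"
    and H: "ordered_graph H" "verts H \<subseteq> {..k}" and H': "ordered_graph H'" "verts H' \<subseteq> {..k'}"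
  shows "reflect m F \<in> ramsey_graphs (reflect k H) (reflect k' H')"
proof -
  have copy: "\<exists>L. is_copy (reflect j G) (reflect m F) L \<and> (\<forall>e \<in> edges L. c e = C)"
    if "\<exists>K. is_copy G F K \<and> (\<forall>e \<in> edges K. c ((\<lambda>v. m - v) ` e) = C)"
      and "ordered_graph G" "verts G \<subseteq> {..j}" for c :: "nat set \<Rightarrow> colour" and C G j
  proof -
    from that(1) obtain K where K: "is_copy G F K" "\<forall>e \<in> edges K. c ((\<lambda>v. m - v) ` e) = C" by blast
    from K(2) have "\<forall>e \<in> edges (reflect m K). c e = C"
      by (simp add: reflect_def)
    with is_copy_reflect[OF K(1) F(2) that(2,3)] show ?thesis by blast
  qed
  have "(\<exists>K. is_copy (reflect k H) (reflect m F) K \<and> (\<forall>e \<in> edges K. c e = Red)) \<or>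
      (\<exists>K. is_copy (reflect k' H') (reflect m F) K \<and> (\<forall>e \<in> edges K. c e = Blue))"
    for c :: "nat set \<Rightarrow> colour"
  proof -
    let ?c = "\<lambda>e. c ((\<lambda>v. m - v) ` e)"
    have "(\<exists>K. is_copy H F K \<and> (\<forall>e \<in> edges K. ?c e = Red)) \<or>
        (\<exists>K. is_copy H' F K \<and> (\<forall>e \<in> edges K. ?c e = Blue))"
      using F(1) by (simp add: ramsey_graphs_def)
    with copy[OF _ H] copy[OF _ H'] show ?thesis by blast
  qed
  moreover have "ordered_graph (reflect m F)"
    using F by (intro ordered_graph_reflect) (simp_all add: ramsey_graphs_def)
  ultimately show ?thesis
    by (simp add: ramsey_graphs_def)
qed

text \<open>Reflect \<open>F\<close>, take a small core for the reflected pair and reflect that core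
  back; the number of vertices is unchanged.\<close>

lemma bounded_cores_reflect:
  assumes "bounded_cores (reflect k H) (reflect k' H')"
    and H: "ordered_graph H" "verts H \<subseteq> {..k}" and H': "ordered_graph H'" "verts H' \<subseteq> {..k'}"
  shows "bounded_cores H H'"
proof -
  from assms(1) obtain N where N: "\<And>F. F \<in> ramsey_graphs (reflect k H) (reflect k' H') \<Longrightarrow>
      \<exists>K \<in> ramsey_graphs (reflect k H) (reflect k' H'). subgraph K F \<and> card (verts K) \<le> N"
    unfolding bounded_cores_def by blast
  have "\<exists>K \<in> ramsey_graphs H H'. subgraph K F \<and> card (verts K) \<le> N"
    if F: "F \<in> ramsey_graphs H H'" for F
  proof -
    have og: "ordered_graph F" using F by (simp add: ramsey_graphs_def)
    then have "finite (verts F)" by (simp add: ordered_graph_def)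
    then obtain m where m: "verts F \<subseteq> {..m}"
      by (auto simp: finite_nat_iff_bounded_le)
    from N[OF ramsey_graphs_reflect[OF F m H H']] obtain K where
      K: "K \<in> ramsey_graphs (reflect k H) (reflect k' H')" "subgraph K (reflect m F)" "card (verts K) \<le> N"
      by blast
    have Km: "verts K \<subseteq> {..m}"
      using K(2) verts_reflect_le[of m F] by (auto simp: subgraph_def)
    have "reflect m K \<in> ramsey_graphs H H'"
      using ramsey_graphs_reflect[OF K(1) Km ordered_graph_reflect[OF H] verts_reflect_le
          ordered_graph_reflect[OF H'] verts_reflect_le]
      by (simp add: reflect_reflect H H')
    moreover have "subgraph (reflect m K) F"
      using subgraph_reflect[OF K(2) verts_reflect_le] reflect_reflect[OF og m] by simp
    ultimately show ?thesis
      using K(3) card_verts_reflect[OF Km] by (intro bexI[of _ "reflect m K"]) auto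
  qed
  then show ?thesis unfolding bounded_cores_def by blast
qed

lemma right_star_reflect:
  assumes "left_star H" "verts H \<subseteq> {..k}"
  shows "right_star (reflect k H)"
proof -
  from assms(1) obtain c where og: "ordered_graph H" and c: "c \<in> verts H"
    "edges H = {{c, v} | v. v \<in> verts H - {c}}" "\<forall>v \<in> verts H - {c}. v < c"
    unfolding left_star_def by blast
  have diff: "(\<lambda>v. k - v) ` verts H - {k - c} = (\<lambda>v. k - v) ` (verts H - {c})"
    using assms(2) c(1) inj_on_image_set_diff[OF inj_on_reflect, of "verts H" "{c}"] by auto
  have "edges (reflect k H) = (\<lambda>v. {k - c, k - v}) ` (verts H - {c})"
  proof -
    have "edges H = (\<lambda>v. {c, v}) ` (verts H - {c})" unfolding c(2) by blast
    then show ?thesis by (simp add: reflect_def image_image)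
  qed
  also have "\<dots> = {{k - c, v} | v. v \<in> verts (reflect k H) - {k - c}}"
    unfolding reflect_def ograph.sel diff by blast
  finally have "edges (reflect k H) = \<dots>" .
  moreover have "k - c < v" if "v \<in> verts (reflect k H) - {k - c}" for v
  proof -
    from that obtain u where u: "u \<in> verts H - {c}" "v = k - u"
      unfolding reflect_def ograph.sel diff by blast
    moreover have "u < c" "c \<le> k"
      using c(1,3) u(1) assms(2) by auto
    ultimately show ?thesis by simp
  qed
  moreover have "k - c \<in> verts (reflect k H)"
    using c(1) by (simp add: reflect_def)
  ultimately show ?thesis
    unfolding right_star_def using ordered_graph_reflect[OF og assms(2)] by blast
qed

lemma mirror_rcat: "mirror (rcat ds) = reflect (sum_list ds) (rcat ds)"
  by (simp add: mirror_def reflect_def verts_rcat Min_Max_atMost Let_def)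

theorem theorem14:
  fixes H H' :: ograph and ds :: "nat list"
  assumes "(right_star H \<and> right_caterpillar ds H') \<or> (left_star H \<and> left_caterpillar ds H')"
    and "length ds \<le> 2 \<or> sorted ds"
  shows "ramsey_finite H H'"
proof (rule ramsey_finite_if_bounded_cores)
  from assms(1) show "bounded_cores H H'"
  proof
    assume "right_star H \<and> right_caterpillar ds H'"
    with assms(2) show ?thesis by (intro bounded_cores_right) auto
  next
    assume left: "left_star H \<and> left_caterpillar ds H'"
    let ?s = "sum_list ds"
    have rcat: "ordered_graph (rcat ds)" "verts (rcat ds) \<subseteq> {..?s}"
      using rcat_wf[of ds] by auto
    have iso: "order_iso (reflect ?s (rcat ds)) H'"
      using left by (simp add: left_caterpillar_def mirror_rcat)
    have H: "ordered_graph H"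
      using left by (simp add: left_star_def)
    have H': "ordered_graph H'"
      using ordered_graph_order_iso[OF iso ordered_graph_reflect[OF rcat]] .
    obtain k k' where k: "verts H \<subseteq> {..k}" and k': "verts H' \<subseteq> {..k'}"
      using H H' by (auto simp: ordered_graph_def finite_nat_iff_bounded_le)
    \<comment> \<open>\<open>H'\<close> is a copy of the mirrored caterpillar, and the two
      reflections of \<open>rcat ds\<close> cancel.\<close>
    have "order_iso (rcat ds) (reflect k' H')"
      using order_iso_reflect[OF iso ordered_graph_reflect[OF rcat] verts_reflect_le k']
      by (simp add: reflect_reflect[OF rcat])
    with left have "right_caterpillar ds (reflect k' H')"
      by (simp add: right_caterpillar_def left_caterpillar_def)
    moreover have "right_star (reflect k H)"
      using left k by (simp add: right_star_reflect)
    ultimately have "bounded_cores (reflect k H) (reflect k' H')"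
      using assms(2) by (intro bounded_cores_right)
    then show ?thesis
      using H k H' k' by (rule bounded_cores_reflect)
  qed
qed

end
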